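(* Let $P\subset\mathbb{R}^d$ be a smooth $d$-dimensional lattice polytope such that $P\cap\mathbb{Z}^d$ equals the vertex set of $P$. Then $P$ is lattice equivalent to a product of unimodular simplices.
   Context: A lattice polytope is smooth if it is simple and at every vertex the primitive integer vectors along the incident edges form a basis of the lattice $\mathbb{Z}^d$. Lattice equivalence means equivalence under an affine map preserving the lattice; a unimodular simplex is one lattice-equivalent to $\operatorname{conv}\{0,e_1,\dots,e_k\}$. *)

theory Defs
  imports "HOL-Analysis.Analysis"
begin

definition int_lattice :: "(real ^ 'n) set" where
  "int_lattice = {x. \<forall>i. x $ i \<in> \<int>}"

definition lattice_polytope :: "(real ^ 'n) set \<Rightarrow> bool" where
  "lattice_polytope P \<longleftrightarrow> (\<exists>V. finite V \<and> V \<subseteq> int_lattice \<and> P = convex hull V)"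

definition vertices :: "(real ^ 'n) set \<Rightarrow> (real ^ 'n) set" where
  "vertices P = {v. v extreme_point_of P}"

definition edges_at :: "(real ^ 'n) set \<Rightarrow> real ^ 'n \<Rightarrow> (real ^ 'n) set set" where
  "edges_at P v = {e. e edge_of P \<and> v \<in> e}"

definition simple_polytope :: "(real ^ 'n) set \<Rightarrow> bool" where
  "simple_polytope P \<longleftrightarrow>
     polytope P \<and> (\<forall>v \<in> vertices P. int (card (edges_at P v)) = aff_dim P)"

definition primitive_vector :: "real ^ 'n \<Rightarrow> bool" where
  "primitive_vector u \<longleftrightarrow> u \<in> int_lattice \<and> u \<noteq> 0 \<and>
     (\<forall>(k::int). \<forall>w \<in> int_lattice. u = of_int k *\<^sub>R w \<longrightarrow> \<bar>k\<bar> = 1)"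

definition primitive_edge_vectors :: "(real ^ 'n) set \<Rightarrow> real ^ 'n \<Rightarrow> (real ^ 'n) set" where
  "primitive_edge_vectors P v =
     {u. primitive_vector u \<and> (\<exists>e \<in> edges_at P v. \<exists>t > 0. v + t *\<^sub>R u \<in> e)}"

definition int_lattice_basis :: "(real ^ 'n) set \<Rightarrow> bool" where
  "int_lattice_basis B \<longleftrightarrow> finite B \<and> B \<subseteq> int_lattice \<and>
     (\<forall>x \<in> int_lattice. \<exists>c :: real ^ 'n \<Rightarrow> int. x = (\<Sum>b\<in>B. of_int (c b) *\<^sub>R b)) \<and>
     (\<forall>c :: real ^ 'n \<Rightarrow> int. (\<Sum>b\<in>B. of_int (c b) *\<^sub>R b) = 0 \<longrightarrow> (\<forall>b\<in>B. c b = 0))"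

definition smooth_polytope :: "(real ^ 'n) set \<Rightarrow> bool" where
  "smooth_polytope P \<longleftrightarrow> lattice_polytope P \<and> simple_polytope P \<and>
     (\<forall>v \<in> vertices P. int_lattice_basis (primitive_edge_vectors P v))"

text \<open>An affine map \<open>x \<mapsto> a + f x\<close> that maps the lattice onto itself is automatically
  bijective: \<open>f\<close> then maps the lattice onto itself as well, hence is surjective.\<close>

definition lattice_equivalent :: "(real ^ 'n) set \<Rightarrow> (real ^ 'n) set \<Rightarrow> bool" where
  "lattice_equivalent P Q \<longleftrightarrow> (\<exists>f a. linear f \<and>
     (\<lambda>x. a + f x) ` int_lattice = int_lattice \<and> Q = (\<lambda>x. a + f x) ` P)"

text \<open>The simplex spanned by the origin and the unit vectors with index in \<open>B\<close>; the choice of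
  the indices is immaterial up to lattice equivalence.\<close>

definition standard_simplex :: "'n set \<Rightarrow> (real ^ 'n) set" where
  "standard_simplex B = convex hull (insert 0 ((\<lambda>i. axis i 1) ` B))"

definition unimodular_simplex :: "(real ^ 'n) set \<Rightarrow> bool" where
  "unimodular_simplex S \<longleftrightarrow> (\<exists>B. lattice_equivalent S (standard_simplex B))"

definition coord_subspace :: "'n set \<Rightarrow> (real ^ 'n) set" where
  "coord_subspace B = {x. \<forall>i. i \<notin> B \<longrightarrow> x $ i = 0}"

definition coord_proj :: "'n set \<Rightarrow> real ^ 'n \<Rightarrow> real ^ 'n" where
  "coord_proj B x = (\<chi> i. if i \<in> B then x $ i else 0)"

text \<open>The decomposition of \<open>\<real>\<^sup>n\<close> as a product of spaces of smaller dimension is given by a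
  partition of the set of coordinates. The factor belonging to a block \<open>B\<close> is represented by the
  coordinate subspace of \<open>B\<close>, and a point lies in the product if each of its components
  lies in the corresponding factor.\<close>

definition product_of_unimodular_simplices :: "(real ^ 'n) set \<Rightarrow> bool" where
  "product_of_unimodular_simplices Q \<longleftrightarrow> (\<exists>\<P> S. partition_on UNIV \<P> \<and>
     (\<forall>B \<in> \<P>. S B \<subseteq> coord_subspace B \<and> unimodular_simplex (S B)) \<and>
     Q = {x. \<forall>B \<in> \<P>. coord_proj B x \<in> S B})"

end

theory Submission
  imports Defs
begin

text \<open>At a vertex \<open>v\<close> with primitive edge vectors \<open>U v\<close>, the polytope lies in the cone
  \<open>v + cone (U v)\<close>, and since there are no lattice points besides the vertices, every edge at \<open>v\<close>
  runs from \<open>v\<close> to \<open>v + u\<close> for some \<open>u \<in> U v\<close>. Comparing the cones at \<open>v\<close> and \<open>v + u\<close> shows that for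
  each other \<open>u' \<in> U v\<close> either \<open>u'\<close> or \<open>u' - u\<close> is an edge vector at \<open>v + u\<close>: the two-dimensional
  face is a unit square or a unimodular triangle. At a fixed vertex \<open>v0\<close>, the triangle case is
  an equivalence relation on the edge vectors, and the cones at the neighbours of \<open>v0\<close> bound the
  coordinate sum over each class by 1, which puts the polytope into a product of simplices.
  Conversely, walking from \<open>v0\<close> along pairwise inequivalent edge vectors never leaves the
  polytope, so all vertices of the product belong to it.\<close>


section \<open>Edges, hyperplane sections and vertex optimality of polytopes\<close>

lemma extreme_point_of_edge_endpoints:
  assumes "closed_segment p q edge_of P"
  shows "p extreme_point_of P" "q extreme_point_of P"
proof -
  have "closed_segment p q face_of P" using assms by (simp add: edge_of_def)
  from extreme_point_of_face[OF this, of p] extreme_point_of_face[OF this, of q]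
  show "p extreme_point_of P" "q extreme_point_of P" by (simp_all add: extreme_point_of_segment)
qed

lemma edge_of_polytope_segment:
  fixes P :: "'a::euclidean_space set"
  assumes "polytope P" "e edge_of P"
  obtains p q where "e = closed_segment p q" "p \<noteq> q"
proof -
  have e: "e face_of P" "aff_dim e = 1" using assms(2) by (auto simp: edge_of_def)
  have "polytope e" using face_of_polytope_polytope[OF assms(1) e(1)] .
  then obtain p q where pq: "e = closed_segment p q"
    using compact_convex_collinear_segment[of e] polytope_imp_compact polytope_imp_convex
      collinear_aff_dim[of e] e(2) aff_dim_empty[of e]
    by (metis order_refl zero_neq_neg_one add.right_neutral one_neq_neg_one)
  then have "p \<noteq> q" using e(2) by auto
  then show thesis using that pq by blast
qed

text \<open>The smallest face \<open>F\<close> containing \<open>x\<close> has \<open>x\<close> in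
  its relative interior. If \<open>F\<close> had dimension at least 2, its section would have
  dimension at least 1, and \<open>x\<close> would be the midpoint of a segment in the section.
  Dimension 0 would make \<open>x\<close> a vertex of \<open>P\<close>, so \<open>F\<close> is an
  edge.\<close>

lemma extreme_point_of_polytope_Int_hyperplane:
  fixes P :: "'a::euclidean_space set"
  assumes "polytope P" and x: "x extreme_point_of (P \<inter> {y. a \<bullet> y = b})" and nx: "\<not> x extreme_point_of P"
  obtains p q where "closed_segment p q edge_of P" "x \<in> open_segment p q"
proof -
  have xP: "x \<in> P" and xb: "a \<bullet> x = b" using x by (auto simp: extreme_point_of_def)
  have cP: "convex P" using assms(1) polytope_imp_convex by blast
  \<comment> \<open>Only faces containing \<open>x\<close> are compared, so \<open>nat\<close> never
    meets the dimension \<open>-1\<close> of the empty face.\<close>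
  obtain F where F: "F face_of P" "x \<in> F"
    and Fmin: "\<And>G. G face_of P \<Longrightarrow> x \<in> G \<Longrightarrow> nat (aff_dim F) \<le> nat (aff_dim G)"
    using ex_has_least_nat[of "\<lambda>F. F face_of P \<and> x \<in> F" P "\<lambda>F. nat (aff_dim F)"]
      face_of_refl[OF cP] xP by blast
  have pF: "polytope F" using F assms(1) face_of_polytope_polytope by blast
  have dF: "aff_dim F \<noteq> -1" using F(2) aff_dim_empty by auto
  have Fri: "x \<in> rel_interior F"
  proof (rule ccontr)
    assume "x \<notin> rel_interior F"
    then obtain G where G: "G facet_of F" "x \<in> G"
      using rel_boundary_of_polyhedron[OF polytope_imp_polyhedron[OF pF]] F(2) by blast
    then have "G face_of P" using F(1) face_of_trans facet_of_imp_face_of by blast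
    moreover have "aff_dim G = aff_dim F - 1" "aff_dim G \<ge> 0"
      using G aff_dim_geq[of G] aff_dim_empty[of G] by (auto simp: facet_of_def)
    ultimately show False using Fmin G(2) by force
  qed
  have "aff_dim F \<le> 1"
  proof (rule ccontr)
    assume 2: "\<not> aff_dim F \<le> 1"
    have xa: "x \<in> affine hull F" using F(2) hull_inc by fast
    let ?A = "affine hull F \<inter> {y. a \<bullet> y = b}"
    have "aff_dim ?A \<ge> 1"
      using 2 xa xb aff_dim_affine_Int_hyperplane[OF affine_affine_hull, of F a b] by auto
    then have "?A \<noteq> {x}" using aff_dim_sing[of x] by (metis not_one_le_zero)
    then obtain y where y: "y \<in> affine hull F" "a \<bullet> y = b" "y \<noteq> x" using xa xb by blast
    obtain e where e: "e > 0" "cball x e \<inter> affine hull F \<subseteq> F"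
      using Fri by (auto simp: mem_rel_interior_cball)
    \<comment> \<open>A direction inside the hyperplane, scaled so that \<open>x + d\<close> and
      \<open>x - d\<close> both stay in the ball of radius \<open>e\<close>, hence in
      \<open>F\<close>.\<close>
    define d where "d = (e / norm (y - x)) *\<^sub>R (y - x)"
    have nd: "norm d = e" using y(3) e by (simp add: d_def)
    have "x + s *\<^sub>R d \<in> F" if "\<bar>s\<bar> = 1" for s
    proof -
      have "x + (s * (e / norm (y - x))) *\<^sub>R (y - x) \<in> affine hull F"
        using mem_affine[OF affine_affine_hull xa y(1), of "1 - s * (e / norm (y - x))" "s * (e / norm (y - x))"]
        by (simp add: algebra_simps)
      moreover have "x + s *\<^sub>R d \<in> cball x e" using nd that by (simp add: dist_norm)
      ultimately show ?thesis using e(2) by (auto simp: d_def)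
    qed
    from this[of 1] this[of "-1"] have "x + d \<in> F" "x - d \<in> F" by auto
    moreover have "a \<bullet> d = 0" using y xb by (simp add: d_def inner_diff_right)
    ultimately have "x + d \<in> P \<inter> {y. a \<bullet> y = b}" "x - d \<in> P \<inter> {y. a \<bullet> y = b}"
      using subsetD[OF face_of_imp_subset[OF F(1)]] xb by (auto simp: inner_add_right inner_diff_right)
    moreover have "x \<in> open_segment (x - d) (x + d)"
    proof -
      have "d \<noteq> 0" using nd e(1) by auto
      moreover have "(x + d) - (x - d) = 2 *\<^sub>R d" by (simp add: scaleR_2)
      ultimately have "x - d \<noteq> x + d" by (metis right_minus_eq scaleR_eq_0_iff zero_neq_numeral)
      moreover have "(x - d) + (x + d) = 2 *\<^sub>R x" by (simp add: scaleR_2)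
      then have "midpoint (x - d) (x + d) = x" by (simp add: midpoint_def)
      ultimately show ?thesis using midpoint_in_open_segment[of "x - d" "x + d"] by simp
    qed
    ultimately show False using x unfolding extreme_point_of_def by blast
  qed
  moreover have "aff_dim F \<noteq> 0"
    using nx F face_of_singleton[of x P] by (auto simp: aff_dim_eq_0)
  ultimately have d1: "aff_dim F = 1" using dF aff_dim_geq[of F] by linarith
  then have "F edge_of P" using F(1) by (simp add: edge_of_def)
  moreover obtain p q where pq: "F = closed_segment p q"
    using edge_of_polytope_segment[OF assms(1) \<open>F edge_of P\<close>] by blast
  ultimately have "x \<in> open_segment p q"
    using nx F(2) extreme_point_of_edge_endpoints[of p q P] by (auto simp: open_segment_def)
  then show thesis using that \<open>F edge_of P\<close> pq by blast
qed

text \<open>The argument of the simplex method: a vertex that is optimal along its edges is optimal. A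
  hyperplane that cuts off the vertex meets the polytope in a set whose extreme points lie on
  the edges at this vertex.\<close>

lemma polytope_vertex_edge_inequality:
  fixes P :: "'a::euclidean_space set"
  assumes "polytope P" and v: "v extreme_point_of P"
    and edge: "\<And>w. w \<noteq> v \<Longrightarrow> closed_segment v w edge_of P \<Longrightarrow> c \<bullet> v \<le> c \<bullet> w"
    and "x \<in> P"
  shows "c \<bullet> v \<le> c \<bullet> x"
proof -
  define W where "W = {w. w extreme_point_of P} - {v}"
  have P: "compact P" "convex P"
    using assms(1) polytope_imp_compact polytope_imp_convex by blast+
  have PV: "P = convex hull insert v W"
    using Krein_Milman_Minkowski[OF P] v by (simp add: W_def insert_absorb)
  have "finite W"
    using finite_polyhedron_extreme_points[OF polytope_imp_polyhedron[OF assms(1)]] by (simp add: W_def)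
  then have "closed (convex hull W)" by (simp add: compact_imp_closed finite_imp_compact_convex_hull)
  moreover have "v \<notin> convex hull W"
  proof
    assume "v \<in> convex hull W"
    then have "P = convex hull W" using PV hull_redundant by metis
    then show False using v extreme_point_of_convex_hull W_def by blast
  qed
  ultimately obtain a b where ab: "a \<bullet> v < b" "\<And>w. w \<in> convex hull W \<Longrightarrow> a \<bullet> w > b"
    using separating_hyperplane_closed_point[OF convex_convex_hull, of W v] by blast
  then have abW: "a \<bullet> w > b" if "w extreme_point_of P" "w \<noteq> v" for w
    using that by (simp add: W_def hull_inc)
  let ?H = "{y. a \<bullet> y = b}" and ?C = "{y. c \<bullet> v \<le> c \<bullet> y}"
  have cC: "convex ?C" by (rule convex_halfspace_ge)
  have "y \<in> ?C" if y: "y extreme_point_of (P \<inter> ?H)" for y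
  proof -
    have yb: "a \<bullet> y = b" using y by (auto simp: extreme_point_of_def)
    then have "\<not> y extreme_point_of P" using abW ab(1) by fastforce
    then obtain p q where pq: "closed_segment p q edge_of P" "y \<in> open_segment p q"
      using extreme_point_of_polytope_Int_hyperplane[OF assms(1) y] by blast
    have ext: "p extreme_point_of P" "q extreme_point_of P"
      using extreme_point_of_edge_endpoints[OF pq(1)] by auto
    obtain u where u: "0 < u" "u < 1" "y = (1 - u) *\<^sub>R p + u *\<^sub>R q" "p \<noteq> q"
      using pq(2) by (auto simp: in_segment)
    \<comment> \<open>If neither endpoint were \<open>v\<close>, both would lie strictly beyond the
      hyperplane, and so would \<open>y\<close>.\<close>
    have "p = v \<or> q = v"
    proof (rule ccontr)
      assume "\<not> ?thesis"
      then have "a \<bullet> p > b" "a \<bullet> q > b" using abW ext by auto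
      then have "(1 - u) * (a \<bullet> p) + u * (a \<bullet> q) > (1 - u) * b + u * b"
        using u by (intro add_strict_mono mult_strict_left_mono) auto
      then show False using yb u by (simp add: inner_add_right algebra_simps)
    qed
    then have "c \<bullet> v \<le> c \<bullet> p" "c \<bullet> v \<le> c \<bullet> q"
      using edge[of p] edge[of q] pq(1) u(4) by (auto simp: closed_segment_commute)
    then have "p \<in> ?C" "q \<in> ?C" by auto
    then show ?thesis using convexD[OF cC, of p q "1 - u" u] u by simp
  qed
  then have "convex hull {y. y extreme_point_of (P \<inter> ?H)} \<subseteq> ?C"
    by (intro hull_minimal cC) auto
  moreover have "P \<inter> ?H = convex hull {y. y extreme_point_of (P \<inter> ?H)}"
    by (rule Krein_Milman_Minkowski[OF compact_Int_closed[OF P(1) closed_hyperplane]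
      convex_Int[OF P(2) convex_hyperplane]])
  ultimately have PH: "P \<inter> ?H \<subseteq> ?C" by (rule ord_eq_le_trans[rotated])
  have "insert v W \<subseteq> ?C"
  proof (rule insert_subsetI)
    show "W \<subseteq> ?C"
    proof
      fix w assume "w \<in> W"
      then have w: "a \<bullet> w > b" "w \<in> P" using abW by (auto simp: W_def extreme_point_of_def)
      \<comment> \<open>The parameter at which the segment from \<open>v\<close> to \<open>w\<close>
        crosses the hyperplane. Since \<open>c\<close> is affine along the segment, the inequality
        at the crossing passes on to \<open>w\<close>.\<close>
      define t where "t = (b - a \<bullet> v) / (a \<bullet> w - a \<bullet> v)"
      have t: "0 < t" "t < 1" "t * (a \<bullet> w - a \<bullet> v) = b - a \<bullet> v"
        using w ab(1) by (auto simp: t_def)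
      let ?y = "(1 - t) *\<^sub>R v + t *\<^sub>R w"
      have "?y \<in> P" using convexD[OF P(2), of v w "1 - t" t] v w(2) t by (simp add: extreme_point_of_def)
      moreover have "a \<bullet> ?y = b" using t(3) by (simp add: inner_add_right algebra_simps)
      ultimately have "c \<bullet> v \<le> c \<bullet> ?y" using PH by blast
      then have "0 \<le> t * (c \<bullet> w - c \<bullet> v)" by (simp add: inner_add_right algebra_simps)
      then show "w \<in> ?C" using t(1) by (simp add: zero_le_mult_iff)
    qed
  qed simp
  then have "P \<subseteq> ?C" unfolding PV by (intro hull_minimal cC)
  then show ?thesis using assms(4) by blast
qed

section \<open>Lattice vectors, dual bases and simplices\<close>

lemma int_lattice_add: "x \<in> int_lattice \<Longrightarrow> y \<in> int_lattice \<Longrightarrow> x + y \<in> int_lattice"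
  and int_lattice_diff: "x \<in> int_lattice \<Longrightarrow> y \<in> int_lattice \<Longrightarrow> x - y \<in> int_lattice"
  by (auto simp: int_lattice_def)

lemma int_lattice_sum: "(\<And>i. i \<in> A \<Longrightarrow> f i \<in> int_lattice) \<Longrightarrow> sum f A \<in> int_lattice"
  by (auto simp: int_lattice_def)

lemma int_lattice_scaleR: "k \<in> \<int> \<Longrightarrow> x \<in> int_lattice \<Longrightarrow> k *\<^sub>R x \<in> int_lattice"
  by (auto simp: int_lattice_def)

lemma int_lattice_inner: "x \<in> int_lattice \<Longrightarrow> y \<in> int_lattice \<Longrightarrow> x \<bullet> y \<in> \<int>"
  by (auto simp: int_lattice_def inner_vec_def)

text \<open>The integer expansions of the unit vectors assemble into the dual vectors
  \<open>c b\<close>. Linearity extends the expansion to all real vectors, and comparing the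
  expansion of \<open>b'\<close> with \<open>b'\<close> itself gives the biorthogonality.\<close>

lemma int_lattice_basis_dual_exists:
  fixes B :: "(real ^ 'n) set"
  assumes B: "int_lattice_basis B"
  shows "\<exists>c. (\<forall>b\<in>B. c b \<in> int_lattice) \<and> (\<forall>x. (\<Sum>b\<in>B. (c b \<bullet> x) *\<^sub>R b) = x) \<and>
    (\<forall>b\<in>B. \<forall>b'\<in>B. c b \<bullet> b' = (if b = b' then 1 else 0))"
proof -
  have "finite B" using B by (simp add: int_lattice_basis_def)
  have "\<exists>k :: real ^ 'n \<Rightarrow> int. axis i 1 = (\<Sum>b\<in>B. of_int (k b) *\<^sub>R b)" for i :: 'n
    using B by (auto simp: int_lattice_basis_def int_lattice_def axis_def)
  then obtain k :: "'n \<Rightarrow> real ^ 'n \<Rightarrow> int"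
    where k: "\<And>i. axis i 1 = (\<Sum>b\<in>B. of_int (k i b) *\<^sub>R b)" by metis
  define c :: "real ^ 'n \<Rightarrow> real ^ 'n" where "c b = (\<chi> i. of_int (k i b))" for b
  have expand: "(\<Sum>b\<in>B. (c b \<bullet> x) *\<^sub>R b) = x" for x
  proof -
    have "x = (\<Sum>i\<in>UNIV. x $ i *\<^sub>R axis i 1)"
      by (simp add: basis_expansion flip: scalar_mult_eq_scaleR)
    also have "\<dots> = (\<Sum>i\<in>UNIV. \<Sum>b\<in>B. (x $ i * of_int (k i b)) *\<^sub>R b)"
      unfolding k by (simp add: scaleR_sum_right)
    also have "\<dots> = (\<Sum>b\<in>B. \<Sum>i\<in>UNIV. (x $ i * of_int (k i b)) *\<^sub>R b)" by (rule sum.swap)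
    also have "\<dots> = (\<Sum>b\<in>B. (c b \<bullet> x) *\<^sub>R b)"
      by (simp add: c_def inner_vec_def mult.commute flip: scaleR_sum_left)
    finally show ?thesis by simp
  qed
  have lat: "c b \<in> int_lattice" for b by (simp add: c_def int_lattice_def)
  have "c b \<bullet> b' = (if b = b' then 1 else 0)" if b: "b \<in> B" "b' \<in> B" for b b'
  proof -
    \<comment> \<open>The independence of \<open>B\<close> is given for integer coefficients, so the
      coefficients of \<open>b'\<close> must first be known to be integers.\<close>
    have "c b \<bullet> b' \<in> \<int>" for b
      using int_lattice_inner[OF lat] B b(2) by (auto simp: int_lattice_basis_def)
    then have "\<forall>b. \<exists>m. c b \<bullet> b' = of_int m" by (metis Ints_cases)
    then obtain m :: "real ^ 'n \<Rightarrow> int" where m: "\<And>b. c b \<bullet> b' = of_int (m b)" by metis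
    have "(\<Sum>b\<in>B. of_int (m b - (if b = b' then 1 else 0)) *\<^sub>R b) = 0"
      using expand[of b'] \<open>finite B\<close> b(2)
      by (simp add: m scaleR_diff_left sum_subtractf if_distrib[of of_int] if_distrib[of "\<lambda>t. t *\<^sub>R _"] cong: if_cong)
    moreover have "\<forall>c :: real ^ 'n \<Rightarrow> int.
        (\<Sum>b\<in>B. of_int (c b) *\<^sub>R b) = 0 \<longrightarrow> (\<forall>b\<in>B. c b = 0)"
      using B by (simp add: int_lattice_basis_def)
    ultimately have "m b - (if b = b' then 1 else 0) = 0"
      using b(1) by (elim allE[of _ "\<lambda>b. m b - (if b = b' then 1 else 0)"]) blast
    then show ?thesis using m[of b] by auto
  qed
  then show ?thesis using lat expand by blast
qed

definition dual_basis :: "(real ^ 'n) set \<Rightarrow> real ^ 'n \<Rightarrow> real ^ 'n" where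
  "dual_basis B = (SOME c. (\<forall>b\<in>B. c b \<in> int_lattice) \<and> (\<forall>x. (\<Sum>b\<in>B. (c b \<bullet> x) *\<^sub>R b) = x) \<and>
    (\<forall>b\<in>B. \<forall>b'\<in>B. c b \<bullet> b' = (if b = b' then 1 else 0)))"

lemma dual_basis:
  assumes "int_lattice_basis B"
  shows dual_basis_in_int_lattice: "b \<in> B \<Longrightarrow> dual_basis B b \<in> int_lattice"
    and dual_basis_expansion: "(\<Sum>b\<in>B. (dual_basis B b \<bullet> x) *\<^sub>R b) = x"
    and dual_basis_inner: "b \<in> B \<Longrightarrow> b' \<in> B \<Longrightarrow> dual_basis B b \<bullet> b' = (if b = b' then 1 else 0)"
  using someI_ex[OF int_lattice_basis_dual_exists[OF assms], folded dual_basis_def] by blast+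

lemma convex_simplex_combination:
  assumes "convex S" "finite B" "y \<in> S" "\<And>i. i \<in> B \<Longrightarrow> y + d i \<in> S"
    and "\<And>i. i \<in> B \<Longrightarrow> 0 \<le> t i" "sum t B \<le> 1"
  shows "y + (\<Sum>i\<in>B. t i *\<^sub>R d i) \<in> S"
proof -
  \<comment> \<open>\<open>None\<close> stands for the base point \<open>y\<close>, which receives
    the remaining weight; indexing by options allows the points to coincide.\<close>
  let ?a = "case_option (1 - sum t B) t" and ?y = "case_option y (\<lambda>i. y + d i)"
  have "(\<Sum>j\<in>insert None (Some ` B). ?a j *\<^sub>R ?y j) \<in> S"
    using assms by (intro convex_sum) (auto simp: sum.reindex split: option.splits)
  moreover have "(\<Sum>j\<in>insert None (Some ` B). ?a j *\<^sub>R ?y j) = y + (\<Sum>i\<in>B. t i *\<^sub>R d i)"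
    using assms(2) by (simp add: sum.reindex scaleR_add_right sum.distrib scaleR_sum_left algebra_simps)
  ultimately show ?thesis by simp
qed

lemma mem_standard_simplex:
  fixes B :: "'n::finite set"
  shows "x \<in> standard_simplex B \<longleftrightarrow>
    (\<forall>i. 0 \<le> x $ i) \<and> (\<Sum>i\<in>B. x $ i) \<le> 1 \<and> (\<forall>i. i \<notin> B \<longrightarrow> x $ i = 0)"
proof -
  have "(\<lambda>i. axis i (1::real)) ` B \<subseteq> Basis" by (auto simp: axis_in_Basis_iff)
  moreover have "inj_on (\<lambda>i. axis i (1::real)) B" by (auto simp: inj_on_def axis_eq_axis)
  ultimately show ?thesis
    unfolding standard_simplex_def
    by (auto simp: substd_simplex sum.reindex inner_axis Basis_vec_def image_iff axis_eq_axis)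
qed

section \<open>Edge vectors at a vertex and at its neighbours\<close>

locale smooth_polytope_without_lattice_points =
  fixes P :: "(real ^ 'd) set"
  assumes smooth: "smooth_polytope P"
    and lattice_points: "P \<inter> int_lattice = vertices P"
begin

abbreviation U :: "real ^ 'd \<Rightarrow> (real ^ 'd) set" where
  "U \<equiv> primitive_edge_vectors P"

abbreviation coord :: "real ^ 'd \<Rightarrow> real ^ 'd \<Rightarrow> real ^ 'd \<Rightarrow> real" where
  "coord v u x \<equiv> dual_basis (U v) u \<bullet> (x - v)"

lemma polytope: "polytope P"
  using smooth by (simp add: smooth_polytope_def simple_polytope_def)

lemma convex: "convex P"
  using polytope polytope_imp_convex by blast

lemma vertexD: "v \<in> vertices P \<Longrightarrow> v \<in> P" "v \<in> vertices P \<Longrightarrow> v \<in> int_lattice"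
  using lattice_points by auto

lemma vertexI: "v \<in> P \<Longrightarrow> v \<in> int_lattice \<Longrightarrow> v \<in> vertices P"
  using lattice_points by auto

lemma basis: "v \<in> vertices P \<Longrightarrow> int_lattice_basis (U v)"
  using smooth by (simp add: smooth_polytope_def)

lemma edge_vector_in_int_lattice: "u \<in> U v \<Longrightarrow> u \<in> int_lattice"
  and edge_vector_nonzero: "u \<in> U v \<Longrightarrow> u \<noteq> 0"
  by (auto simp: primitive_edge_vectors_def primitive_vector_def)

text \<open>For \<open>r > 1\<close> the lattice point \<open>v + z\<close> would lie strictly
  between two points of \<open>P\<close>; it would be a vertex by assumption, but not
  extreme.\<close>

lemma no_lattice_step:
  assumes "v \<in> P" "v \<in> int_lattice" "v + r *\<^sub>R z \<in> P" "z \<in> int_lattice" "z \<noteq> 0"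
  shows "r \<le> 1"
proof (rule ccontr)
  assume "\<not> r \<le> 1"
  then have r: "r > 1" by simp
  have eq: "v + z = (1 - 1/r) *\<^sub>R v + (1/r) *\<^sub>R (v + r *\<^sub>R z)"
    using r by (simp add: algebra_simps)
  then have seg: "v + z \<in> open_segment v (v + r *\<^sub>R z)"
    unfolding in_segment using r assms(5) by (intro conjI exI[of _ "1/r"]) auto
  moreover have "v + z \<in> P"
    using convexD[OF convex assms(1,3), of "1 - 1/r" "1/r"] r eq by simp
  then have "v + z \<in> vertices P" using vertexI int_lattice_add assms by blast
  ultimately show False using assms(1,3) by (auto simp: vertices_def extreme_point_of_def)
qed

text \<open>The far endpoint of an edge in direction \<open>u\<close> is \<open>v\<close> plus
  \<open>r\<close> times \<open>u\<close>, where \<open>r > 0\<close> is the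
  \<open>u\<close>-coordinate of a lattice vector and thus an integer;
  \<open>no_lattice_step\<close> leaves \<open>r = 1\<close>. Conversely, a proper divisor of an
  edge would be a forbidden shorter lattice step.\<close>

lemma edge_vectors:
  assumes v: "v \<in> vertices P"
  shows "u \<in> U v \<longleftrightarrow> u \<noteq> 0 \<and> closed_segment v (v + u) edge_of P"
proof
  assume u: "u \<in> U v"
  then obtain e t where e: "e edge_of P" "v \<in> e" "t > 0" "v + t *\<^sub>R u \<in> e"
    by (auto simp: primitive_edge_vectors_def edges_at_def)
  obtain p q where pq: "e = closed_segment p q" "p \<noteq> q"
    using edge_of_polytope_segment[OF polytope e(1)] .
  have "v extreme_point_of e"
    using v e extreme_point_of_face by (auto simp: vertices_def edge_of_def)
  then have "v = p \<or> v = q" using pq extreme_point_of_segment by blast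
  then obtain w where w: "e = closed_segment v w" "w \<noteq> v"
    using pq by (metis closed_segment_commute)
  then obtain s where s: "0 \<le> s" "v + t *\<^sub>R u = (1 - s) *\<^sub>R v + s *\<^sub>R w"
    using e(4) by (auto simp: in_segment)
  then have su: "t *\<^sub>R u = s *\<^sub>R (w - v)" by (simp add: algebra_simps)
  then have "s \<noteq> 0" using e(3) edge_vector_nonzero[OF u] by auto
  define r where "r = t / s"
  have r: "r > 0" using s(1) \<open>s \<noteq> 0\<close> e(3) by (simp add: r_def)
  have "r *\<^sub>R u = (1/s) *\<^sub>R (t *\<^sub>R u)" by (simp add: r_def)
  then have wr: "w = v + r *\<^sub>R u" using \<open>s \<noteq> 0\<close> by (simp add: su)
  have wP: "w \<in> vertices P"
    using extreme_point_of_edge_endpoints(2) e(1) w(1) by (auto simp: vertices_def)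
  have "dual_basis (U v) u \<bullet> (w - v) = r"
    using dual_basis_inner[OF basis[OF v] u u] by (simp add: wr)
  moreover have "dual_basis (U v) u \<bullet> (w - v) \<in> \<int>"
    using dual_basis_in_int_lattice[OF basis[OF v] u] vertexD(2) v wP
    by (intro int_lattice_inner int_lattice_diff) auto
  ultimately have "r \<in> \<int>" by simp
  then have "r \<ge> 1" using r by (metis Ints_cases of_int_0_less_iff of_int_1_le_iff zless_imp_add1_zle add_0)
  moreover have "r \<le> 1"
    using no_lattice_step[of v r u] v wP vertexD edge_vector_nonzero[OF u] edge_vector_in_int_lattice[OF u]
    by (auto simp: wr)
  ultimately show "u \<noteq> 0 \<and> closed_segment v (v + u) edge_of P"
    using w(1) wr e(1) edge_vector_nonzero[OF u] by simp
next
  assume u: "u \<noteq> 0 \<and> closed_segment v (v + u) edge_of P"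
  then have "v + u \<in> vertices P"
    using extreme_point_of_edge_endpoints(2) by (auto simp: vertices_def)
  then have lat: "u \<in> int_lattice" "v + u \<in> P" using vertexD int_lattice_diff[of "v + u" v] v by auto
  have "\<bar>k\<bar> = 1" if k: "z \<in> int_lattice" "u = of_int k *\<^sub>R z" for k z
  proof -
    have "k \<noteq> 0" "z \<noteq> 0" using u k by auto
    \<comment> \<open>\<open>no_lattice_step\<close> only bounds factors from above, so the sign of
      \<open>k\<close> is moved into the lattice vector.\<close>
    have "\<bar>of_int k :: real\<bar> \<le> 1"
    proof (rule no_lattice_step[of v])
      show "v + \<bar>of_int k\<bar> *\<^sub>R (sgn (of_int k) *\<^sub>R z) \<in> P"
        using lat(2) k(2) by (simp add: abs_mult_sgn)
      show "sgn (of_int k) *\<^sub>R z \<in> int_lattice"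
        using k(1) by (intro int_lattice_scaleR) (auto simp: sgn_if)
    qed (use v vertexD \<open>k \<noteq> 0\<close> \<open>z \<noteq> 0\<close> in \<open>auto simp: sgn_if\<close>)
    then show ?thesis using \<open>k \<noteq> 0\<close> by linarith
  qed
  then have "primitive_vector u" using lat u by (simp add: primitive_vector_def)
  moreover have "closed_segment v (v + u) \<in> edges_at P v" using u by (simp add: edges_at_def)
  ultimately show "u \<in> U v"
    unfolding primitive_edge_vectors_def
    by (intro CollectI conjI bexI[of _ "closed_segment v (v + u)"] exI[of _ 1]) auto
qed

lemma edge_vector_vertex:
  assumes "v \<in> vertices P" "u \<in> U v"
  shows "v + u \<in> vertices P"
  using assms edge_vectors extreme_point_of_edge_endpoints(2) by (fastforce simp: vertices_def)

lemma edge_vector_reverse: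
  assumes "v \<in> vertices P" "u \<in> U v"
  shows "- u \<in> U (v + u)"
  using assms edge_vectors[of v u] edge_vectors[OF edge_vector_vertex[OF assms], of "- u"]
  by (auto simp: closed_segment_commute)

text \<open>\<open>P\<close> lies in the cone at \<open>v\<close>: the functional is 0 or 1 on every
  edge vector at \<open>v\<close>, so \<open>v\<close> minimizes it along its edges and therefore on
  all of \<open>P\<close>.\<close>

lemma coord_nonneg:
  assumes v: "v \<in> vertices P" and u: "u \<in> U v" and x: "x \<in> P"
  shows "coord v u x \<ge> 0"
proof -
  have "dual_basis (U v) u \<bullet> v \<le> dual_basis (U v) u \<bullet> w"
    if "w \<noteq> v" "closed_segment v w edge_of P" for w
  proof -
    have "w - v \<in> U v" using edge_vectors[OF v, of "w - v"] that by simp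
    then have "dual_basis (U v) u \<bullet> (w - v) \<ge> 0" using dual_basis_inner[OF basis[OF v] u] by simp
    then show ?thesis by (simp add: inner_diff_right)
  qed
  then show ?thesis
    using polytope_vertex_edge_inequality[OF polytope, of v "dual_basis (U v) u" x] v x
    by (simp add: vertices_def inner_diff_right)
qed


text \<open>In the cone at \<open>w = v + u\<close>, the vector \<open>u' - u\<close> is a
  nonnegative combination of edge vectors, and some \<open>z\<close> occurring in it has a positive
  \<open>u'\<close>-coordinate. The cone at \<open>v\<close> confines \<open>z\<close> to the plane
  of \<open>u\<close> and \<open>u'\<close>; integrality makes its \<open>u'\<close>-coordinate 1,
  and its \<open>u\<close>-coordinate can only be 0 or -1.\<close>

lemma edge_vector_step:
  assumes v: "v \<in> vertices P" and u: "u \<in> U v" and u': "u' \<in> U v" and ne: "u \<noteq> u'"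
  shows "u' \<in> U (v + u) \<or> u' - u \<in> U (v + u)"
proof -
  define w where "w = v + u"
  have w: "w \<in> vertices P" using edge_vector_vertex[OF v u] by (simp add: w_def)
  note bv = basis[OF v] and bw = basis[OF w]
  have fin: "finite (U v)" "finite (U w)" using bv bw by (auto simp: int_lattice_basis_def)
  define c where "c = dual_basis (U v)"
  define k where "k z = coord w z (v + u')" for z
  have cu: "c y \<bullet> u = (if y = u then 1 else 0)" "c y \<bullet> u' = (if y = u' then 1 else 0)"
    if "y \<in> U v" for y
    using that dual_basis_inner[OF bv that] u u' by (auto simp: c_def)
  have k0: "k z \<ge> 0" if "z \<in> U w" for z
    using coord_nonneg[OF w that] vertexD(1)[OF edge_vector_vertex[OF v u']] by (simp add: k_def)
  have "u' - u = (\<Sum>z\<in>U w. k z *\<^sub>R z)"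
    using dual_basis_expansion[OF bw, of "v + u' - w"] by (simp add: k_def w_def)
  then have csum: "c y \<bullet> (u' - u) = (\<Sum>z\<in>U w. k z * (c y \<bullet> z))" for y
    by (simp add: inner_sum_right)
  \<comment> \<open>The left-hand side is the \<open>y\<close>-coordinate, seen from
    \<open>v\<close>, of the vertex \<open>w + z\<close>.\<close>
  have z0: "c y \<bullet> u + c y \<bullet> z \<ge> 0" if "y \<in> U v" "z \<in> U w" for y z
    using coord_nonneg[OF v that(1)] vertexD(1)[OF edge_vector_vertex[OF w that(2)]]
    by (fastforce simp: c_def w_def inner_simps)
  have "\<exists>z\<in>U w. k z * (c u' \<bullet> z) > 0"
  proof (rule ccontr)
    assume "\<not> ?thesis"
    then have "(\<Sum>z\<in>U w. k z * (c u' \<bullet> z)) \<le> 0" by (intro sum_nonpos) (auto simp: not_less)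
    then show False using csum[of u'] cu[OF u'] ne by (simp add: inner_diff_right)
  qed
  then obtain z where z: "z \<in> U w" "k z * (c u' \<bullet> z) > 0" by blast
  have kz: "k z > 0" "c u' \<bullet> z > 0" using z k0[OF z(1)] by (auto simp: zero_less_mult_iff)
  \<comment> \<open>The nonnegative terms of \<open>csum\<close> add up to
    \<open>c y \<bullet> (u' - u) = 0\<close>, so each of them vanishes.\<close>
  have other: "c y \<bullet> z = 0" if y: "y \<in> U v" "y \<noteq> u" "y \<noteq> u'" for y
  proof -
    have "c y \<bullet> z' \<ge> 0" if "z' \<in> U w" for z' using z0[OF y(1) that] cu[OF y(1)] y by simp
    moreover have "(\<Sum>z\<in>U w. k z * (c y \<bullet> z)) = 0"
      using csum[of y] cu[OF y(1)] y by (simp add: inner_diff_right)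
    ultimately have "k z * (c y \<bullet> z) = 0"
      using sum_nonneg_eq_0_iff[OF fin(2), of "\<lambda>z. k z * (c y \<bullet> z)"] k0 z(1) by simp
    then show ?thesis using kz by simp
  qed
  define a b where "a = c u \<bullet> z" and "b = c u' \<bullet> z"
  have "z = (\<Sum>y\<in>U v. (c y \<bullet> z) *\<^sub>R y)" using dual_basis_expansion[OF bv, of z] by (simp add: c_def)
  also have "\<dots> = (\<Sum>y\<in>{u, u'}. (c y \<bullet> z) *\<^sub>R y)"
    using u u' other fin by (intro sum.mono_neutral_right) auto
  finally have zab: "z = a *\<^sub>R u + b *\<^sub>R u'" using ne by (simp add: a_def b_def)
  have "a \<in> \<int>" "b \<in> \<int>"
    using dual_basis_in_int_lattice[OF bv] u u' edge_vector_in_int_lattice[OF z(1)]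
    by (auto simp: a_def b_def c_def intro: int_lattice_inner)
  then obtain m n where mn: "a = of_int m" "b = of_int n" by (metis Ints_cases)
  have mu: "- u \<in> U w" using edge_vector_reverse[OF v u] by (simp add: w_def)
  \<comment> \<open>As \<open>z\<close> and \<open>- u\<close> are distinct basis vectors at
    \<open>w\<close>, the functional dual to \<open>z\<close> kills \<open>u\<close>. Evaluated at
    \<open>z\<close>, it shows that the positive integer \<open>b\<close> divides 1.\<close>
  have "z \<noteq> - u" using kz(2) cu[OF u'] ne by auto
  then have "dual_basis (U w) z \<bullet> u = 0" "dual_basis (U w) z \<bullet> z = 1"
    using dual_basis_inner[OF bw z(1) mu] dual_basis_inner[OF bw z(1) z(1)] by auto
  then have "b * (dual_basis (U w) z \<bullet> u') = 1" unfolding zab by (simp add: inner_simps)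
  moreover have "dual_basis (U w) z \<bullet> u' \<in> \<int>"
    using dual_basis_in_int_lattice[OF bw z(1)] edge_vector_in_int_lattice[OF u'] int_lattice_inner by blast
  then obtain l where "dual_basis (U w) z \<bullet> u' = of_int l" by (metis Ints_cases)
  ultimately have "n * l = 1" unfolding mn by (metis of_int_eq_1_iff of_int_mult)
  moreover have "n > 0" using kz(2) mn(2) by (simp add: b_def)
  ultimately have "b = 1" unfolding mn by (simp add: zmult_eq_1_iff)
  then have z1: "z = a *\<^sub>R u + u'" using zab by simp
  have "a \<ge> -1" using z0[OF u z(1)] cu[OF u] by (simp add: a_def)
  \<comment> \<open>The vertex \<open>w + z\<close> is reached from the vertex \<open>v + u'\<close>
    by \<open>a + 1\<close> steps along \<open>u\<close>.\<close>
  moreover have "a + 1 \<le> 1"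
  proof (rule no_lattice_step[of "v + u'" _ u])
    have "(v + u') + (a + 1) *\<^sub>R u = w + z" by (simp add: z1 w_def algebra_simps)
    then show "(v + u') + (a + 1) *\<^sub>R u \<in> P" using vertexD(1)[OF edge_vector_vertex[OF w z(1)]] by simp
    show "v + u' \<in> P" "v + u' \<in> int_lattice" using vertexD edge_vector_vertex[OF v u'] by auto
  qed (use u edge_vector_in_int_lattice edge_vector_nonzero in auto)
  ultimately have "m = 0 \<or> m = -1" unfolding mn by linarith
  then have "z = u' \<or> z = u' - u" using z1 mn(1) by auto
  then show ?thesis using z(1) by (auto simp: w_def)
qed

text \<open>This is the facet inequality seen from \<open>v + u\<close>: the coordinate along
  \<open>- u\<close> there is nonnegative on \<open>P\<close>, and its functional is -1 on
  \<open>u\<close> and on \<open>J\<close> and at most 0 on the other edge vectors at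
  \<open>v\<close>.\<close>

lemma edge_inequality:
  assumes v: "v \<in> vertices P" and u: "u \<in> U v" and J: "J \<subseteq> U v - {u}"
    and step: "\<And>y. y \<in> J \<Longrightarrow> y - u \<in> U (v + u)" and x: "x \<in> P"
  shows "coord v u x + (\<Sum>y\<in>J. coord v y x) \<le> 1"
proof -
  define w where "w = v + u"
  have w: "w \<in> vertices P" using edge_vector_vertex[OF v u] by (simp add: w_def)
  have mu: "- u \<in> U w" using edge_vector_reverse[OF v u] by (simp add: w_def)
  have fin: "finite (U v)" using basis[OF v] by (auto simp: int_lattice_basis_def)
  then have finJ: "finite J" using J by (meson finite_Diff finite_subset)
  define h where "h = dual_basis (U w) (- u)"
  have hu: "h \<bullet> u = -1" using dual_basis_inner[OF basis[OF w] mu mu] by (simp add: h_def)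
  have h1: "h \<bullet> y = -1" if "y - u \<in> U w" "y \<in> U v" for y
  proof -
    have "y - u \<noteq> - u" using edge_vector_nonzero[OF that(2)] by simp
    then have "h \<bullet> (y - u) = 0"
      using dual_basis_inner[OF basis[OF w] mu that(1)] by (simp add: h_def)
    then show ?thesis using hu by (simp add: inner_diff_right)
  qed
  have h0: "h \<bullet> y \<le> 0" if y: "y \<in> U v" for y
  proof (cases "y = u")
    case False
    then consider "y \<in> U w" | "y - u \<in> U w" using edge_vector_step[OF v u y] by (auto simp: w_def)
    then show ?thesis
    proof cases
      case 1
      \<comment> \<open>The \<open>u\<close>-coordinate tells \<open>y\<close> from
        \<open>- u\<close>, so these are two different basis vectors at \<open>w\<close>.\<close>
      have "dual_basis (U v) u \<bullet> y = 0" "dual_basis (U v) u \<bullet> (- u) = -1"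
        using dual_basis_inner[OF basis[OF v] u] y u False by auto
      then have "- u \<noteq> y" by auto
      then show ?thesis using dual_basis_inner[OF basis[OF w] mu 1] by (simp add: h_def)
    next
      case 2
      then show ?thesis using h1[OF _ y] by simp
    qed
  next
    case True
    then show ?thesis using hu by simp
  qed
  let ?t = "\<lambda>y. coord v y x"
  have "0 \<le> h \<bullet> (x - w)" using coord_nonneg[OF w mu x] by (simp add: h_def)
  \<comment> \<open>The summand 1 is \<open>h \<bullet> (v - w)\<close>, that is, \<open>h\<close>
    at \<open>- u\<close>.\<close>
  also have "\<dots> = 1 + h \<bullet> (x - v)" using hu by (simp add: w_def inner_simps)
  also have "h \<bullet> (x - v) = (\<Sum>y\<in>U v. ?t y * (h \<bullet> y))"
    by (subst dual_basis_expansion[OF basis[OF v], of "x - v", symmetric]) (simp add: inner_sum_right)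
  also have "\<dots> \<le> (\<Sum>y\<in>U v. if y \<in> insert u J then - ?t y else 0)"
  proof (rule sum_mono)
    fix y assume y: "y \<in> U v"
    show "?t y * (h \<bullet> y) \<le> (if y \<in> insert u J then - ?t y else 0)"
    proof (cases "y \<in> insert u J")
      case True
      then have "h \<bullet> y = -1" using hu h1[OF _ y] step by (auto simp: w_def)
      then show ?thesis using True by simp
    next
      case False
      then show ?thesis using h0[OF y] coord_nonneg[OF v y x] by (simp add: mult_nonneg_nonpos)
    qed
  qed
  also have "\<dots> = (\<Sum>y\<in>insert u J. - ?t y)"
    using fin J u by (subst sum.inter_restrict[symmetric]) (auto intro!: sum.cong)
  also have "\<dots> = - (?t u + (\<Sum>y\<in>J. ?t y))"
    using finJ J by (subst sum.insert) (auto simp: sum_negf)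
  finally show ?thesis by simp
qed

text \<open>The triangle case would bound the sum of the two coordinates by 1, which
  \<open>x\<close> violates; so \<open>x\<close> is a witness for the square case.\<close>

lemma edge_vector_persists:
  assumes "v \<in> vertices P" "u \<in> U v" "u' \<in> U v" "u \<noteq> u'" "x \<in> P"
    and "coord v u x = 1" "coord v u' x = 1"
  shows "u' \<in> U (v + u)"
  using edge_vector_step[OF assms(1-4)] edge_inequality[OF assms(1,2), of "{u'}" x] assms by auto

section \<open>Equivalence of directions at a fixed vertex\<close>

context
  fixes v0 :: "real ^ 'd" and e :: "'d \<Rightarrow> real ^ 'd"
  assumes v0: "v0 \<in> vertices P" and e: "bij_betw e UNIV (U v0)"
begin

lemma e_mem: "e i \<in> U v0"
  using e bij_betwE by blast

lemma e_eq_iff: "e i = e j \<longleftrightarrow> i = j"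
  using e by (auto simp: bij_betw_def inj_on_def)

lemma dual_e: "dual_basis (U v0) (e i) \<bullet> e j = (if i = j then 1 else 0)"
  using dual_basis_inner[OF basis[OF v0] e_mem e_mem] by (simp add: e_eq_iff)

lemma e_expansion: "(\<Sum>i\<in>UNIV. coord v0 (e i) x *\<^sub>R e i) = x - v0"
  using dual_basis_expansion[OF basis[OF v0], of "x - v0"]
    sum.reindex_bij_betw[OF e, of "\<lambda>u. coord v0 u x *\<^sub>R u"] by simp

lemma e_neq_uminus: "e i \<noteq> - e j"
proof
  assume "e i = - e j"
  then have "dual_basis (U v0) (e i) \<bullet> e i = - (dual_basis (U v0) (e i) \<bullet> e j)"
    by (metis inner_minus_right)
  then show False by (simp add: dual_e split: if_splits)
qed

text \<open>The triangle case of \<open>edge_vector_step\<close> at \<open>v0\<close>, with equality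
  added for reflexivity.\<close>

definition equivalent_directions :: "'d \<Rightarrow> 'd \<Rightarrow> bool" (infix "\<bowtie>" 50) where
  "i \<bowtie> j \<longleftrightarrow> i = j \<or> e j - e i \<in> U (v0 + e i)"

text \<open>\<open>edge_inequality\<close> with the largest possible \<open>J\<close>. The sum runs
  over the directions related to \<open>i\<close> because transitivity is not yet known; it will
  follow from this bound.\<close>

lemma equivalent_directions_inequality:
  assumes "x \<in> P"
  shows "(\<Sum>j | i \<bowtie> j. coord v0 (e j) x) \<le> 1"
proof -
  let ?J = "{j. i \<bowtie> j} - {i}"
  have "coord v0 (e i) x + (\<Sum>y\<in>e ` ?J. coord v0 y x) \<le> 1"
    using e_mem assms by (intro edge_inequality v0) (auto simp: e_eq_iff equivalent_directions_def)
  then have "coord v0 (e i) x + (\<Sum>j\<in>?J. coord v0 (e j) x) \<le> 1"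
    by (subst (asm) sum.reindex) (auto simp: inj_on_def e_eq_iff)
  moreover have "i \<in> {j. i \<bowtie> j}" by (simp add: equivalent_directions_def)
  ultimately show ?thesis by (subst sum.remove[of _ i]) simp_all
qed

text \<open>In the square case, the edge \<open>e j\<close> at \<open>v0 + e i\<close> leads to the
  fourth corner.\<close>

lemma nonequivalent_directions:
  assumes "\<not> i \<bowtie> j"
  shows "v0 + e i + e j \<in> vertices P"
proof -
  have "e j \<in> U (v0 + e i)"
    using assms edge_vector_step[OF v0 e_mem e_mem, of i j]
    by (auto simp: equivalent_directions_def e_eq_iff)
  then show ?thesis by (rule edge_vector_vertex[OF edge_vector_vertex[OF v0 e_mem]])
qed

text \<open>Symmetry reverses the edge from \<open>v0 + e i\<close> to \<open>v0 + e j\<close>. If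
  transitivity failed, the square corner \<open>v0 + e i + e k\<close> would lie in \<open>P\<close>
  with coordinate sum 2 over the directions related to \<open>j\<close>.\<close>

lemma equivalent_directions_equiv: "equiv UNIV {(i, j). i \<bowtie> j}"
proof (rule equivI)
  show "refl {(i, j). i \<bowtie> j}" by (auto simp: refl_on_def equivalent_directions_def)
  show "sym {(i, j). i \<bowtie> j}"
    using edge_vector_reverse[OF edge_vector_vertex[OF v0 e_mem]]
    by (fastforce simp: sym_def equivalent_directions_def)
  show "trans {(i, j). i \<bowtie> j}"
  proof (rule transI, clarify, rule ccontr)
    fix i j k assume ij: "i \<bowtie> j" and jk: "j \<bowtie> k" and ik: "\<not> i \<bowtie> k"
    have "j \<bowtie> i" using ij \<open>sym _\<close> by (auto simp: sym_def)
    have "i \<noteq> k" using ik by (auto simp: equivalent_directions_def)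
    define x where "x = v0 + e i + e k"
    have x: "coord v0 (e l) x = (if l = i then 1 else 0) + (if l = k then 1 else 0)" for l
      by (simp add: x_def inner_simps dual_e)
    have "(\<Sum>l\<in>{i, k}. coord v0 (e l) x) \<le> (\<Sum>l | j \<bowtie> l. coord v0 (e l) x)"
      using \<open>j \<bowtie> i\<close> jk by (intro sum_mono2) (auto simp: x)
    also have "\<dots> \<le> 1"
      using nonequivalent_directions[OF ik] vertexD(1)
      by (intro equivalent_directions_inequality) (auto simp: x_def)
    finally show False using \<open>i \<noteq> k\<close> by (simp add: x)
  qed
qed auto

section \<open>Walks along pairwise inequivalent directions\<close>

definition transversal :: "'d set \<Rightarrow> bool" where
  "transversal I \<longleftrightarrow> (\<forall>i\<in>I. \<forall>j\<in>I. i \<bowtie> j \<longrightarrow> i = j)"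

text \<open>To continue the walk, the induction also tracks edge vectors: directions unrelated to
  \<open>I\<close> stay available, and steps already taken can be undone. Both properties survive a
  step \<open>e j\<close> by \<open>edge_vector_persists\<close>.\<close>

lemma transversal_vertex:
  assumes "transversal I"
  shows "v0 + sum e I \<in> vertices P \<and> (\<forall>j. (\<forall>i\<in>I. \<not> i \<bowtie> j) \<longrightarrow> e j \<in> U (v0 + sum e I)) \<and>
    (\<forall>i\<in>I. - e i \<in> U (v0 + sum e I))"
  using finite[of I] assms
proof (induction I rule: finite_induct)
  case empty
  then show ?case using v0 e_mem by simp
next
  case (insert j I)
  define v where "v = v0 + sum e I"
  have "transversal I" using insert.prems by (auto simp: transversal_def)
  then have IH: "v \<in> vertices P" "\<And>j. (\<forall>i\<in>I. \<not> i \<bowtie> j) \<Longrightarrow> e j \<in> U v" "\<And>i. i \<in> I \<Longrightarrow> - e i \<in> U v"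
    using insert.IH by (auto simp: v_def)
  have w: "v0 + sum e (insert j I) = v + e j" using insert.hyps by (simp add: v_def algebra_simps)
  have "\<not> i \<bowtie> j" if "i \<in> I" for i
    using insert.prems insert.hyps(2) that by (auto simp: transversal_def)
  then have j: "e j \<in> U v" using IH(2) by blast
  have dual_v: "dual_basis (U v) y \<bullet> y' = (if y = y' then 1 else 0)" if "y \<in> U v" "y' \<in> U v" for y y'
    using dual_basis_inner[OF basis[OF IH(1)] that] .
  have dual_sum: "dual_basis (U v) y \<bullet> sum e I = - (\<Sum>i\<in>I. if y = - e i then 1 else 0)" if "y \<in> U v" for y
  proof -
    have "dual_basis (U v) y \<bullet> e i = - (if y = - e i then 1 else 0)" if "i \<in> I" for i
      using dual_v[OF \<open>y \<in> U v\<close> IH(3)[OF that]] by simp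
    then show ?thesis by (simp add: inner_sum_right sum_negf)
  qed
  have "- e i \<in> U (v + e j)" if i: "i \<in> I" for i
  \<comment> \<open>Seen from \<open>v\<close>, the witness \<open>v0 + e j\<close> is reached by
    undoing every step of \<open>I\<close> and adding \<open>e j\<close>, so its coordinates along
    \<open>e j\<close> and each \<open>- e i\<close> are 1.\<close>
  proof (rule edge_vector_persists[OF IH(1) j IH(3)[OF i], of "v0 + e j"])
    show "v0 + e j \<in> P" using edge_vector_vertex[OF v0 e_mem] vertexD(1) by blast
    have eq: "v0 + e j - v = e j - sum e I" by (simp add: v_def)
    show "coord v (e j) (v0 + e j) = 1" "coord v (- e i) (v0 + e j) = 1"
      unfolding eq using dual_v[OF j j] dual_v[OF IH(3)[OF i] j] dual_sum[OF j] dual_sum[OF IH(3)[OF i]]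
        e_neq_uminus[of j] i
      by (auto simp: inner_diff_right e_eq_iff)
  qed (use e_neq_uminus in auto)
  moreover have "- e j \<in> U (v + e j)" using edge_vector_reverse[OF IH(1) j] .
  moreover have "e k \<in> U (v + e j)" if k: "\<forall>i\<in>insert j I. \<not> i \<bowtie> k" for k
  proof -
    have ek: "e k \<in> U v" "j \<noteq> k" using IH(2) k by (auto simp: equivalent_directions_def)
    show ?thesis
    \<comment> \<open>The witness is the fourth corner of the square at \<open>v0\<close> spanned by
      the inequivalent directions \<open>j\<close> and \<open>k\<close>.\<close>
    proof (rule edge_vector_persists[OF IH(1) j ek(1), of "v0 + e j + e k"])
      show "v0 + e j + e k \<in> P" using nonequivalent_directions[of j k] k vertexD(1) by blast
      have eq: "v0 + e j + e k - v = e j + e k - sum e I" by (simp add: v_def)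
      show "coord v (e j) (v0 + e j + e k) = 1" "coord v (e k) (v0 + e j + e k) = 1"
        unfolding eq using dual_v[OF j j] dual_v[OF ek(1) j] dual_v[OF j ek(1)] dual_v[OF ek(1) ek(1)]
          dual_sum[OF j] dual_sum[OF ek(1)] e_neq_uminus ek(2)
        by (auto simp: inner_diff_right inner_add_right e_eq_iff)
    qed (use ek in \<open>auto simp: e_eq_iff\<close>)
  qed
  ultimately show ?case using edge_vector_vertex[OF IH(1) j] by (auto simp: w)
qed

section \<open>The polytope as a product over the classes\<close>

definition blocks :: "'d set set" where
  "blocks = UNIV // {(i, j). i \<bowtie> j}"

lemma partition_blocks: "partition_on UNIV blocks"
  unfolding blocks_def using partition_on_quotient equivalent_directions_equiv by blast

lemma block_eq:
  assumes "B \<in> blocks" "i \<in> B"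
  shows "B = {j. i \<bowtie> j}"
proof -
  obtain k where "B = {(i, j). i \<bowtie> j} `` {k}"
    using assms(1) unfolding blocks_def by (rule quotientE)
  moreover from this have "(k, i) \<in> {(i, j). i \<bowtie> j}" using assms(2) by simp
  ultimately show ?thesis using equiv_class_eq[OF equivalent_directions_equiv] by auto
qed

text \<open>Fractional coordinates are filled in block by block. The point with \<open>B\<close>
  filled is a convex combination of the point with nothing in \<open>B\<close> and the points with a
  single \<open>e i\<close> for \<open>i \<in> B\<close>; in the latter \<open>i\<close> joins
  \<open>I\<close>, so the induction must keep \<open>I\<close> arbitrary.\<close>

lemma partial_fill:
  assumes t: "\<And>i. 0 \<le> t i" "\<And>B. B \<in> blocks \<Longrightarrow> sum t B \<le> 1"
    and "\<C> \<subseteq> blocks" "transversal I" "\<And>B. B \<in> \<C> \<Longrightarrow> I \<inter> B = {}"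
  shows "v0 + sum e I + (\<Sum>B\<in>\<C>. \<Sum>i\<in>B. t i *\<^sub>R e i) \<in> P"
  using finite[of \<C>] assms(3-5)
proof (induction \<C> arbitrary: I rule: finite_induct)
  case empty
  then show ?case using transversal_vertex vertexD(1) by simp
next
  case (insert B \<C>)
  define y where "y I = v0 + sum e I + (\<Sum>B\<in>\<C>. \<Sum>i\<in>B. t i *\<^sub>R e i)" for I
  have B: "B \<in> blocks" "I \<inter> B = {}" using insert.prems by auto
  have "y I \<in> P" using insert.IH insert.prems by (simp add: y_def)
  moreover have "y I + e i \<in> P" if i: "i \<in> B" for i
  proof -
    have "y (insert i I) \<in> P" unfolding y_def
    proof (rule insert.IH)
      have "\<not> i \<bowtie> k" "\<not> k \<bowtie> i" if "k \<in> I" for k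
        using that B block_eq[OF B(1) i] equivalent_directions_equiv
        by (auto simp: equiv_def sym_def)
      then show "transversal (insert i I)"
        using insert.prems(2) by (auto simp: transversal_def)
      show "insert i I \<inter> C = {}" if C: "C \<in> \<C>" for C
      proof -
        have "C \<in> blocks" "C \<noteq> B" using C insert.prems(1) insert.hyps(2) by auto
        then have "i \<notin> C" using block_eq[OF B(1) i] block_eq[of C i] by auto
        then show ?thesis using insert.prems(3)[of C] C by auto
      qed
    qed (use insert.prems(1) in simp)
    moreover have "i \<notin> I" using B i by blast
    ultimately show ?thesis by (simp add: y_def algebra_simps)
  qed
  ultimately have "y I + (\<Sum>i\<in>B. t i *\<^sub>R e i) \<in> P"
    using t B(1) by (intro convex_simplex_combination convex) auto
  then show ?case using insert.hyps by (simp add: y_def algebra_simps)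
qed

text \<open>The inequalities come from the cones at \<open>v0\<close> and its neighbours; their
  sufficiency is \<open>partial_fill\<close> with \<open>I\<close> empty and all blocks
  filled.\<close>

lemma mem_iff_coord:
  "x \<in> P \<longleftrightarrow> (\<forall>i. 0 \<le> coord v0 (e i) x) \<and> (\<forall>B\<in>blocks. (\<Sum>i\<in>B. coord v0 (e i) x) \<le> 1)"
proof (intro iffI conjI allI ballI)
  fix i assume "x \<in> P"
  then show "0 \<le> coord v0 (e i) x" by (rule coord_nonneg[OF v0 e_mem])
next
  fix B assume "x \<in> P" "B \<in> blocks"
  moreover obtain i where "i \<in> B"
    using \<open>B \<in> blocks\<close> partition_blocks by (metis partition_onD3 ex_in_conv)
  ultimately show "(\<Sum>i\<in>B. coord v0 (e i) x) \<le> 1"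
    using equivalent_directions_inequality[of x i] block_eq by simp
next
  let ?t = "\<lambda>i. coord v0 (e i) x"
  assume "(\<forall>i. 0 \<le> ?t i) \<and> (\<forall>B\<in>blocks. sum ?t B \<le> 1)"
  then have "v0 + sum e {} + (\<Sum>B\<in>blocks. \<Sum>i\<in>B. ?t i *\<^sub>R e i) \<in> P"
    by (intro partial_fill) (auto simp: transversal_def)
  moreover have "(\<Sum>B\<in>blocks. \<Sum>i\<in>B. ?t i *\<^sub>R e i) = (\<Sum>i\<in>\<Union>blocks. ?t i *\<^sub>R e i)"
    using partition_blocks
    by (subst sum.Union_disjoint) (auto simp: partition_on_def disjoint_def)
  moreover have "\<Union>blocks = UNIV" using partition_blocks by (simp add: partition_on_def)
  ultimately show "x \<in> P" by (simp add: e_expansion)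
qed

text \<open>Passing to coordinates at \<open>v0\<close> preserves the lattice in both directions,
  since dual vectors and edge vectors are integral, and it turns \<open>mem_iff_coord\<close> into
  the description of a product of standard simplices.\<close>

lemma lattice_equivalent_product_at_vertex:
  "\<exists>Q. product_of_unimodular_simplices Q \<and> lattice_equivalent P Q"
proof (intro exI conjI)
  define f where "f x = (\<chi> i. dual_basis (U v0) (e i) \<bullet> x)" for x
  let ?g = "\<lambda>x. - f v0 + f x"
  have f: "linear f" by (auto simp: f_def inner_simps vec_eq_iff intro!: linearI)
  have g: "?g x $ i = coord v0 (e i) x" for x i by (simp add: f_def inner_simps)
  \<comment> \<open>A right inverse of \<open>?g\<close>, supplying the preimages for both image
    equations.\<close>
  define h where "h y = v0 + (\<Sum>i\<in>UNIV. y $ i *\<^sub>R e i)" for y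
  have "?g (h y) $ i = y $ i" for y i
    unfolding g by (simp add: h_def inner_sum_right dual_e if_distrib cong: if_cong)
  then have gh: "?g (h y) = y" for y by (simp only: vec_eq_iff) simp
  let ?Q = "{x. \<forall>B\<in>blocks. coord_proj B x \<in> standard_simplex B}"
  have proj: "coord_proj B x \<in> standard_simplex B \<longleftrightarrow> (\<forall>i\<in>B. 0 \<le> x $ i) \<and> (\<Sum>i\<in>B. x $ i) \<le> 1" for B x
    by (auto simp: mem_standard_simplex coord_proj_def)
  have Q: "x \<in> ?Q \<longleftrightarrow> (\<forall>i. 0 \<le> x $ i) \<and> (\<forall>B\<in>blocks. (\<Sum>i\<in>B. x $ i) \<le> 1)" for x
    using partition_onD1[OF partition_blocks] by (auto simp: proj)
  have gQ: "?g x \<in> ?Q \<longleftrightarrow> x \<in> P" for x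
    unfolding Q g by (rule mem_iff_coord[symmetric])
  show "lattice_equivalent P ?Q"
    unfolding lattice_equivalent_def
  proof (intro exI[of _ f] exI[of _ "- f v0"] conjI f)
    show "?g ` int_lattice = int_lattice"
    proof (intro subset_antisym subsetI)
      fix y assume "y \<in> ?g ` int_lattice"
      then obtain x where x: "y = ?g x" "x \<in> int_lattice" by (rule imageE)
      have "coord v0 (e i) x \<in> \<int>" for i
        using dual_basis_in_int_lattice[OF basis[OF v0] e_mem] vertexD(2)[OF v0] x(2)
        by (intro int_lattice_inner int_lattice_diff)
      then show "y \<in> int_lattice" unfolding x(1) int_lattice_def using g by auto
    next
      fix y :: "real ^ 'd" assume y: "y \<in> int_lattice"
      then have "h y \<in> int_lattice"
        unfolding h_def using vertexD(2)[OF v0] edge_vector_in_int_lattice[OF e_mem]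
        by (intro int_lattice_add int_lattice_sum int_lattice_scaleR) (auto simp: int_lattice_def)
      then show "y \<in> ?g ` int_lattice" by (rule rev_image_eqI) (simp only: gh)
    qed
    show "?Q = ?g ` P"
    proof (intro subset_antisym subsetI)
      fix y assume "y \<in> ?Q"
      then have "?g (h y) \<in> ?Q" unfolding gh .
      then have "h y \<in> P" unfolding gQ .
      then show "y \<in> ?g ` P" by (rule rev_image_eqI) (simp only: gh)
    next
      fix y assume "y \<in> ?g ` P"
      then obtain x where x: "y = ?g x" "x \<in> P" by (rule imageE)
      show "y \<in> ?Q" unfolding x(1) gQ by (rule x(2))
    qed
  qed
  show "product_of_unimodular_simplices ?Q"
    unfolding product_of_unimodular_simplices_def
  proof (intro exI[of _ blocks] exI[of _ standard_simplex] conjI partition_blocks ballI)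
    fix B
    show "standard_simplex B \<subseteq> coord_subspace B"
      by (auto simp: mem_standard_simplex coord_subspace_def)
    have "lattice_equivalent (standard_simplex B) (standard_simplex B)"
      unfolding lattice_equivalent_def
      by (intro exI[of _ "\<lambda>x. x"] exI[of _ 0]) (auto intro: linear_id[unfolded id_def])
    then show "unimodular_simplex (standard_simplex B)" by (auto simp: unimodular_simplex_def)
  qed simp
qed

end

text \<open>The lattice basis is also a real basis: dual vectors isolate coefficients, which gives
  independence, and the dual expansion gives spanning. Hence the edge vectors can be indexed by the
  coordinates.\<close>

lemma bij_betw_edge_vectors:
  assumes "v \<in> vertices P"
  obtains e where "bij_betw e (UNIV :: 'd set) (U v)"
proof -
  note b = basis[OF assms]
  have fin: "finite (U v)" using b by (simp add: int_lattice_basis_def)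
  have "independent (U v)"
    unfolding independent_explicit_finite_subsets
  proof (intro allI impI ballI)
    fix A c y assume A: "A \<subseteq> U v" "finite A" "(\<Sum>x\<in>A. c x *\<^sub>R x) = 0" "y \<in> A"
    have dual: "dual_basis (U v) y \<bullet> x = (if y = x then 1 else 0)" if "x \<in> A" for x
      using dual_basis_inner[OF b] A(1,4) that by blast
    have "0 = dual_basis (U v) y \<bullet> (\<Sum>x\<in>A. c x *\<^sub>R x)" using A(3) by simp
    also have "\<dots> = (\<Sum>x\<in>A. if y = x then c x else 0)"
      unfolding inner_sum_right by (rule sum.cong) (auto simp: dual)
    finally show "c y = 0" using A by simp
  qed
  moreover have "x \<in> span (U v)" for x
    by (subst dual_basis_expansion[OF b, of x, symmetric]) (intro span_sum span_mul span_base)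
  then have "span (U v) = span UNIV" by auto
  ultimately have "card (U v) = CARD('d)"
    using dim_eq_card[of "U v" UNIV] dim_UNIV[where 'a = "real ^ 'd"] by simp
  then show thesis using that finite_same_card_bij[of "UNIV :: 'd set" "U v"] fin by auto
qed

end

theorem theorem3p30:
  fixes P :: "(real ^ 'd) set"
  assumes "smooth_polytope P"
    and "aff_dim P = int CARD('d)"
    and "P \<inter> int_lattice = vertices P"
  shows "\<exists>Q. product_of_unimodular_simplices Q \<and> lattice_equivalent P Q"
proof -
  interpret smooth_polytope_without_lattice_points P
    using assms by unfold_locales
  have "P \<noteq> {}" using assms(2) aff_dim_empty[of P] by auto
  then obtain v where v: "v \<in> vertices P"
    using extreme_point_exists_convex[OF polytope_imp_compact[OF polytope] convex]
    by (auto simp: vertices_def)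
  then obtain e where "bij_betw e (UNIV :: 'd set) (U v)" by (rule bij_betw_edge_vectors)
  with v show ?thesis by (rule lattice_equivalent_product_at_vertex)
qed

end
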